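(* For all integers $n \ge 1$ and $1 \le k \le n$, \[ R_{\bullet}(n,k) = k\,(n-1)(n-2)\cdots(n-k+1)\, n^{\,n-k-1}, \] where for $k=1$ the product $(n-1)\cdots(n-k+1)$ is empty and equals $1$.
   Context: A rooted tree on $[n]=\{1,\dots,n\}$ is a labelled tree with vertex set $[n]$ and one distinguished vertex, the root. A vertex $v$ of a rooted tree is a record if its label is the largest label on the unique path from $v$ to the root (both endpoints included); in particular the root is always a record. $R_{\bullet}(n,k)$ denotes the number of rooted trees on $[n]$ with exactly $k$ records. *)

theory Defs
  imports Complex_Main "Graph_Theory.Graph_Theory"
begin

text \<open>
  A simple undirected graph is represented as in Graph_Theory, by a symmetric loop-free digraph
  without parallel arcs (\<^locale>\<open>pair_graph\<close>), each edge being a pair of opposite arcs. In this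
  representation going along an edge and back is a directed cycle of length 2, so the library's
  notion of a tree does not apply; the cycles of the undirected graph are exactly the directed
  cycles of length at least 3.
\<close>

definition is_labelled_tree :: "nat \<Rightarrow> nat pair_pre_digraph \<Rightarrow> bool" where
  "is_labelled_tree n T \<longleftrightarrow>
     pair_graph T \<and> pverts T = {1..n} \<and>
     Digraph_Component.connected (with_proj T) \<and>
     \<not> (\<exists>c. pre_digraph.cycle (with_proj T) c \<and> 3 \<le> length c)"

definition rooted_trees :: "nat \<Rightarrow> (nat pair_pre_digraph \<times> nat) set" where
  "rooted_trees n = {(T, r). is_labelled_tree n T \<and> r \<in> pverts T}"

text \<open>In a tree there is exactly one path from \<open>v\<close> to \<open>r\<close>, so the existential quantifier
  over \<open>p\<close> just names that path.\<close>

definition is_record :: "nat pair_pre_digraph \<Rightarrow> nat \<Rightarrow> nat \<Rightarrow> bool" where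
  "is_record T r v \<longleftrightarrow>
     (\<exists>p. pre_digraph.apath (with_proj T) v p r \<and>
          v = Max (set (pre_digraph.awalk_verts (with_proj T) v p)))"

definition records :: "nat pair_pre_digraph \<Rightarrow> nat \<Rightarrow> nat set" where
  "records T r = {v \<in> pverts T. is_record T r v}"

definition R_bullet :: "nat \<Rightarrow> nat \<Rightarrow> nat" where
  "R_bullet n k = card {(T, r) \<in> rooted_trees n. card (records T r) = k}"

end

theory Submission
  imports Defs "HOL-Library.FuncSet" "HOL-Combinatorics.Transposition"
begin

text \<open>
  Orient a rooted tree towards its root \<open>r\<close> and encode it by its parent map \<open>f\<close>, with \<open>f r = r\<close>;
  a vertex is a record iff no iterate of \<open>f\<close> exceeds it. If the maximal label \<open>m\<close> is not the root,
  cutting the edge from \<open>m\<close> to its parent splits the tree into the subtree of descendants of \<open>m\<close>,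
  in which \<open>m\<close> is the only record, and a tree \<open>A\<close> with one record less; conversely \<open>m\<close> may be
  attached to any vertex of \<open>A\<close>. Since the number of trees on \<open>s\<close> vertices rooted at a given vertex
  is \<open>s ^ (s - 2)\<close>, the resulting recursion for the number of trees with \<open>k\<close> records is an instance
  of Abel's binomial identity. Cayley's formula itself comes out of the same induction: by symmetry
  the total number of rooted trees is \<open>n\<close> times the number with one record, and the terms with at
  least two records have a telescoping sum.
\<close>

section \<open>Abel polynomials\<close>

text \<open>Abel's polynomials: the value at \<open>k\<close> counts forests on \<open>n + k\<close>
  vertices with \<open>k\<close> prescribed roots, the value at 1 trees on \<open>n + 1\<close>
  vertices with a prescribed root. At \<open>n = 0\<close> the truncated exponent would give
  \<open>x\<close> instead of \<open>x * x^(-1) = 1\<close>.\<close>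

definition abel_poly :: "nat \<Rightarrow> real \<Rightarrow> real" where
  "abel_poly n x = (if n = 0 then 1 else x * (x + real n) ^ (n - 1))"

lemma abel_poly_0 [simp]: "abel_poly 0 x = 1"
  by (simp add: abel_poly_def)

lemma abel_poly_at_0: "n > 0 \<Longrightarrow> abel_poly n 0 = 0"
  by (simp add: abel_poly_def)

text \<open>For \<open>n > 0\<close> the product rule leaves \<open>(x + n + 1) ^ (n - 1)\<close>
  times \<open>x + n + 1 + n * x = (n + 1) * (x + 1)\<close>.\<close>

lemma abel_poly_has_derivative:
  "(abel_poly (Suc n) has_real_derivative real (Suc n) * abel_poly n (x + 1)) (at x)"
proof (cases n)
  case 0
  then show ?thesis
    by (auto simp: abel_poly_def [abs_def] intro!: derivative_eq_intros)
next
  case (Suc m)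
  have "((\<lambda>x. x * (x + real (Suc n)) ^ n) has_real_derivative
      (x + real (Suc n)) ^ n + x * (real n * (x + real (Suc n)) ^ (n - 1))) (at x)"
    by (auto intro!: derivative_eq_intros)
  then show ?thesis
    unfolding Suc by (simp add: abel_poly_def [abs_def] algebra_simps)
qed

lemma abel_poly_has_derivative' [derivative_intros]:
  assumes "(g has_real_derivative g') (at x)"
  shows "((\<lambda>x. abel_poly (Suc n) (g x)) has_real_derivative
           real (Suc n) * abel_poly n (g x + 1) * g') (at x)"
  using DERIV_chain2 [OF abel_poly_has_derivative assms] by simp

text \<open>Both sides have the same derivative in \<open>x\<close> (by the identity one degree lower)
  and agree at \<open>x = 0\<close>.\<close>

lemma abel_poly_binomial:
  "(\<Sum>j\<le>n. real (n choose j) * abel_poly j x * abel_poly (n - j) y) = abel_poly n (x + y)"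
proof (induction n arbitrary: x)
  case 0
  then show ?case by simp
next
  case (Suc n)
  define F where "F = (\<lambda>x. \<Sum>j\<le>Suc n. real (Suc n choose j) * abel_poly j x * abel_poly (Suc n - j) y)"
  \<comment> \<open>The term \<open>j = 0\<close> is constant in \<open>x\<close>; split off, it
    leaves only factors with index \<open>Suc j\<close>, to which the derivative rule
    applies.\<close>
  have F_alt: "F = (\<lambda>x. abel_poly (Suc n) y +
      (\<Sum>j\<le>n. real (Suc n choose Suc j) * abel_poly (Suc j) x * abel_poly (n - j) y))"
    unfolding F_def by (subst sum.atMost_Suc_shift) simp
  have coeff: "real (Suc n choose Suc j) * real (Suc j) = real (Suc n) * real (n choose j)" for j
    by (metis Suc_times_binomial mult.commute of_nat_mult)
  have "(F has_real_derivative real (Suc n) * abel_poly n (x + y + 1)) (at x)" for x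
  proof -
    have "(F has_real_derivative
        (\<Sum>j\<le>n. real (Suc n choose Suc j) * (real (Suc j) * abel_poly j (x + 1)) * abel_poly (n - j) y)) (at x)"
      unfolding F_alt
      by (auto intro!: derivative_eq_intros sum.cong simp del: of_nat_Suc binomial_Suc_Suc)
    also have "(\<Sum>j\<le>n. real (Suc n choose Suc j) * (real (Suc j) * abel_poly j (x + 1)) * abel_poly (n - j) y)
        = (\<Sum>j\<le>n. real (Suc n) * (real (n choose j) * abel_poly j (x + 1) * abel_poly (n - j) y))"
      by (rule sum.cong) (simp_all only: mult.assoc [symmetric] coeff)
    also have "\<dots> = real (Suc n) * abel_poly n (x + 1 + y)"
      by (simp only: sum_distrib_left [symmetric] Suc.IH)
    finally show ?thesis by (simp add: ac_simps)
  qed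
  moreover have "((\<lambda>x. abel_poly (Suc n) (x + y)) has_real_derivative
      real (Suc n) * abel_poly n (x + y + 1)) (at x)" for x
    by (auto intro!: derivative_eq_intros)
  ultimately have "((\<lambda>x. F x - abel_poly (Suc n) (x + y)) has_real_derivative 0) (at x)" for x
    using DERIV_diff by fastforce
  then have "F x - abel_poly (Suc n) (x + y) = F 0 - abel_poly (Suc n) (0 + y)"
    by (rule DERIV_isconst_all [rule_format])
  also have "\<dots> = 0"
    by (simp add: F_alt abel_poly_at_0)
  finally show ?case by (simp add: F_def)
qed

section \<open>The expected counts: recursion, sum over \<open>k\<close>, closed form\<close>

text \<open>For \<open>1 \<le> k \<le> n\<close> this is the falling factorial
  \<open>(n-1)...(n-k+1)\<close> times \<open>k * n^(n-k-1)\<close>; the Abel polynomial gives the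
  latter its value 1 at \<open>k = n\<close> without a negative exponent.\<close>

definition record_count :: "nat \<Rightarrow> nat \<Rightarrow> real" where
  "record_count n k = fact (k - 1) * real ((n - 1) choose (k - 1)) * abel_poly (n - k) (real k)"

text \<open>Numerical form of the cut at the maximum: \<open>a\<close> is the size of the part that
  keeps the root, and the factor \<open>a\<close> counts the attachment points. Once the binomials
  are regrouped, the sum over \<open>a - k\<close> is Abel's identity at \<open>k\<close> and
  1.\<close>

lemma record_count_rec:
  assumes "k \<ge> 1"
  shows "(\<Sum>a\<le>n. real (n choose a) * (abel_poly (n - a) 1 * record_count a k * real a))
         = record_count (Suc n) (Suc k)"
proof (cases "k \<le> n")
  case False
  \<comment> \<open>The factor \<open>real a\<close> matters at \<open>a = 0\<close>, where
    truncated subtraction makes \<open>record_count 0 1\<close> equal to 1.\<close>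
  have "record_count a k * real a = 0" if "a \<le> n" for a
    using that False assms by (auto simp: record_count_def binomial_eq_0)
  with False show ?thesis
    by (auto simp: record_count_def binomial_eq_0 mult.assoc intro!: sum.neutral)
next
  case True
  have absorb: "real ((a - 1) choose (k - 1)) * real a = real k * real (a choose k)" for a
    using assms Suc_times_binomial [of "k - 1" "a - 1"]
    by (cases a; cases k) (auto simp flip: of_nat_mult simp: mult.commute simp del: of_nat_Suc binomial_Suc_Suc)
  have term_eq: "real (n choose a) * (abel_poly (n - a) 1 * record_count a k * real a) =
      fact k * real ((n choose a) * (a choose k)) * (abel_poly (a - k) (real k) * abel_poly (n - a) 1)" for a
  proof -
    have "real (n choose a) * (abel_poly (n - a) 1 * record_count a k * real a) =
       real (n choose a) * abel_poly (n - a) 1 * fact (k - 1) * abel_poly (a - k) (real k) *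
         (real ((a - 1) choose (k - 1)) * real a)"
      by (simp add: record_count_def)
    also have "\<dots> = real (n choose a) * abel_poly (n - a) 1 * (real k * fact (k - 1)) *
        abel_poly (a - k) (real k) * real (a choose k)"
      by (simp only: absorb) simp
    also have "real k * fact (k - 1) = fact k"
      using assms by (simp add: fact_reduce)
    finally show ?thesis by (simp add: ac_simps)
  qed
  \<comment> \<open>The vanishing terms \<open>a < k\<close> are dropped first, since the regrouping
    of \<open>(n choose a) * (a choose k)\<close> by \<open>choose_mult\<close> requires
    \<open>k \<le> a\<close>.\<close>
  have "(\<Sum>a\<le>n. real (n choose a) * (abel_poly (n - a) 1 * record_count a k * real a)) =
     (\<Sum>a\<in>{k..n}. real (n choose a) * (abel_poly (n - a) 1 * record_count a k * real a))"
    by (rule sum.mono_neutral_right) (auto simp: term_eq binomial_eq_0)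
  also have "\<dots> = (\<Sum>a\<in>{k..n}. fact k * real (n choose k) *
      (real ((n - k) choose (a - k)) * abel_poly (a - k) (real k) * abel_poly (n - a) 1))"
    by (rule sum.cong) (auto simp: term_eq choose_mult)
  also have "\<dots> = (\<Sum>j\<le>n - k. fact k * real (n choose k) *
      (real ((n - k) choose j) * abel_poly j (real k) * abel_poly (n - k - j) 1))"
    by (rule sum.reindex_bij_witness [of _ "\<lambda>j. j + k" "\<lambda>a. a - k"]) (use True in auto)
  also have "\<dots> = fact k * real (n choose k) * abel_poly (n - k) (real k + 1)"
    by (simp only: sum_distrib_left [symmetric] abel_poly_binomial)
  finally show ?thesis by (simp add: record_count_def add.commute)
qed

lemma sum_record_count:
  assumes "n \<ge> 1"
  shows "(\<Sum>k=1..n. record_count n k) = real n ^ (n - 1)"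
proof -
  obtain N where n: "n = Suc N" using assms by (cases n) auto
  \<comment> \<open>The telescoping function: \<open>h k\<close> is
    \<open>(n-1)...(n-k) * n^(n-1-k)\<close>, with \<open>h 0 = n^(n-1)\<close> and
    \<open>h n = 0\<close>.\<close>
  define h where "h = (\<lambda>k. fact k * real (N choose k) * real n ^ (N - k))"
  have step: "record_count n (Suc k) = h k - h (Suc k)" if "k \<le> N" for k
  proof (cases "k = N")
    case True
    then show ?thesis by (simp add: record_count_def h_def n)
  next
    case False
    with that obtain j where j: "N = Suc (k + j)"
      by (metis less_iff_Suc_add le_neq_implies_less)
    have "real (Suc k) * real (N choose Suc k) = real (Suc j) * real (N choose k)"
      using binomial_absorb_comp [of N k] binomial_absorption [of k N] j
      by (metis Suc_eq_plus1 Suc_times_binomial_add add.commute add_Suc_right of_nat_mult)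
    then have "h (Suc k) = fact k * real (N choose k) * real (Suc j) * real n ^ j"
      by (simp add: h_def j del: of_nat_Suc binomial_Suc_Suc)
    moreover have "h k = fact k * real (N choose k) * real n ^ j * real n"
      by (simp add: h_def j)
    moreover have "record_count n (Suc k) = fact k * real (N choose k) * (real (Suc k) * real n ^ j)"
      by (simp add: record_count_def n j abel_poly_def algebra_simps)
    \<comment> \<open>One factor \<open>n\<close> of \<open>h k\<close> is split into
      \<open>k + 1\<close>, which yields the record count, and \<open>n - 1 - k\<close>, which
      yields \<open>h (Suc k)\<close>.\<close>
    moreover have "real n = real (Suc k) + real (Suc j)"
      by (simp add: n j)
    ultimately show ?thesis by (simp add: algebra_simps)
  qed
  have "(\<Sum>k=1..n. record_count n k) = (\<Sum>k<Suc N. record_count n (Suc k))"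
    unfolding n by (rule sum.reindex_bij_witness [of _ Suc "\<lambda>k. k - 1"]) auto
  also have "\<dots> = (\<Sum>k<Suc N. h k - h (Suc k))"
    by (rule sum.cong) (auto simp: step)
  also have "\<dots> = h 0 - h (Suc N)"
    by (rule sum_lessThan_telescope')
  finally show ?thesis by (simp add: h_def n)
qed

lemma record_count_closed_form:
  assumes "1 \<le> k" "k \<le> n"
  shows "record_count n k =
    real k * (\<Prod>i = 1..k - 1. real n - real i) * real n powi (int n - int k - 1)"
proof -
  have "fact (k - 1) * real ((n - 1) choose (k - 1)) = (\<Prod>i<k - 1. real (n - 1) - real i)"
    by (simp add: binomial_gbinomial gbinomial_prod_rev atLeast0LessThan)
  also have "\<dots> = (\<Prod>i = 1..k - 1. real n - real i)"
    by (rule prod.reindex_bij_witness [of _ "\<lambda>i. i - 1" Suc]) (use assms in \<open>auto simp: of_nat_diff\<close>)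
  finally have falling: "fact (k - 1) * real ((n - 1) choose (k - 1)) = (\<Prod>i = 1..k - 1. real n - real i)" .
  have "abel_poly (n - k) (real k) = real k * real n powi (int n - int k - 1)"
  proof (cases "n = k")
    \<comment> \<open>The exponent is -1 here, and \<open>k * n^(-1) = 1\<close> is the value of
      \<open>abel_poly 0\<close>.\<close>
    case True
    then show ?thesis using assms by (simp add: power_int_minus)
  next
    case False
    then have "int n - int k - 1 = int (n - k - 1)"
      using assms by auto
    then have "real n powi (int n - int k - 1) = real n ^ (n - k - 1)"
      by (simp only: power_int_of_nat)
    with False assms show ?thesis by (simp add: abel_poly_def of_nat_diff)
  qed
  then show ?thesis by (simp only: record_count_def falling mult.assoc mult.left_commute)
qed

section \<open>Parent maps and their records\<close>

text \<open>Fixing the root makes all iterates total, and being the identity outside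
  \<open>V\<close> makes the map determined by its values on \<open>V\<close>, so that maps can be
  counted. Reaching \<open>r\<close> from everywhere expresses both connectedness and
  acyclicity.\<close>

definition parent_maps :: "'a set \<Rightarrow> 'a \<Rightarrow> ('a \<Rightarrow> 'a) set" where
  "parent_maps V r = {f. r \<in> V \<and> f ` V \<subseteq> V \<and> (\<forall>x. x \<notin> V \<longrightarrow> f x = x) \<and> f r = r \<and>
     (\<forall>v\<in>V. \<exists>i. (f ^^ i) v = r)}"

lemma parent_mapsD:
  assumes "f \<in> parent_maps V r"
  shows "r \<in> V" "x \<in> V \<Longrightarrow> f x \<in> V" "x \<notin> V \<Longrightarrow> f x = x" "f r = r"
    and "x \<in> V \<Longrightarrow> \<exists>i. (f ^^ i) x = r"
  using assms by (auto simp: parent_maps_def)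

lemma funpow_in_verts:
  assumes "f \<in> parent_maps V r" "x \<in> V"
  shows "(f ^^ i) x \<in> V"
  by (induction i) (use assms parent_mapsD(2) [OF assms(1)] in auto)

lemma funpow_fixpoint: "f r = r \<Longrightarrow> (f ^^ i) r = r"
  by (induction i) auto

text \<open>Going \<open>i\<close> times round the period takes \<open>l * i \<ge> i\<close> steps,
  by which time the orbit has been absorbed by the fixed point \<open>r\<close>.\<close>

lemma parent_maps_periodic:
  assumes f: "f \<in> parent_maps V r" and x: "x \<in> V" and l: "l > 0" "(f ^^ l) x = x"
  shows "x = r"
proof -
  obtain i where i: "(f ^^ i) x = r"
    using parent_mapsD(5) [OF f x] by blast
  have "(f ^^ (l * i)) x = x"
    by (induction i) (use l in \<open>auto simp: funpow_add\<close>)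
  moreover have "(f ^^ (l * i)) x = (f ^^ (l * i - i)) ((f ^^ i) x)"
    using l by (subst o_apply [symmetric], subst funpow_add [symmetric]) simp
  ultimately show ?thesis
    using i funpow_fixpoint [of f r, OF parent_mapsD(4) [OF f]] by simp
qed

lemma finite_parent_maps:
  assumes "finite V"
  shows "finite (parent_maps V r)"
proof (rule inj_on_finite)
  show "inj_on (\<lambda>f. restrict f V) (parent_maps V r)"
    by (rule inj_onI, rule ext) (metis parent_mapsD(3) restrict_apply')
  show "(\<lambda>f. restrict f V) ` parent_maps V r \<subseteq> V \<rightarrow>\<^sub>E V"
    by (auto dest: parent_mapsD(2))
  show "finite (V \<rightarrow>\<^sub>E V)"
    using assms by (simp add: finite_PiE)
qed

text \<open>Relabelling by the swap of \<open>r\<close> and \<open>s\<close> moves the root from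
  \<open>r\<close> to \<open>s\<close>; iterates are conjugated along.\<close>

lemma conj_transpose_parent_maps:
  assumes f: "f \<in> parent_maps V r" and s: "s \<in> V"
  defines "\<sigma> \<equiv> Transposition.transpose r s"
  shows "\<sigma> \<circ> f \<circ> \<sigma> \<in> parent_maps V s"
proof -
  have r: "r \<in> V" using parent_mapsD(1) [OF f] .
  have \<sigma>: "\<sigma> x \<in> V \<longleftrightarrow> x \<in> V" "\<sigma> (\<sigma> x) = x" "\<sigma> s = r" "\<sigma> r = s" for x
    using r s by (auto simp: \<sigma>_def Transposition.transpose_def)
  have pow: "((\<sigma> \<circ> f \<circ> \<sigma>) ^^ i) x = \<sigma> ((f ^^ i) (\<sigma> x))" for i x
    by (induction i) (auto simp: \<sigma>)
  have "\<exists>i. ((\<sigma> \<circ> f \<circ> \<sigma>) ^^ i) v = s" if "v \<in> V" for v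
    using parent_mapsD(5) [OF f, of "\<sigma> v"] that \<sigma> unfolding pow by metis
  then show ?thesis
    using s parent_mapsD(2-4) [OF f] \<sigma> by (auto simp: parent_maps_def)
qed

lemma card_parent_maps_root_indep:
  assumes "r \<in> V" "s \<in> V"
  shows "card (parent_maps V r) = card (parent_maps V s)"
proof -
  define c :: "('a \<Rightarrow> 'a) \<Rightarrow> 'a \<Rightarrow> 'a"
    where "c = (\<lambda>f. Transposition.transpose r s \<circ> f \<circ> Transposition.transpose r s)"
  have "bij_betw c (parent_maps V r) (parent_maps V s)"
  proof (rule bij_betw_byWitness [where f' = c])
    show "\<forall>f\<in>parent_maps V r. c (c f) = f" "\<forall>f\<in>parent_maps V s. c (c f) = f"
      by (auto simp: c_def fun_eq_iff)
    show "c ` parent_maps V r \<subseteq> parent_maps V s"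
      using conj_transpose_parent_maps assms(2) by (auto simp: c_def)
    show "c ` parent_maps V s \<subseteq> parent_maps V r"
      using conj_transpose_parent_maps [of _ V s r] assms(1)
      by (auto simp: c_def Transposition.transpose_commute)
  qed
  then show ?thesis by (rule bij_betw_same_card)
qed

lemma card_parent_maps_singleton: "card (parent_maps {r} r) = 1"
proof -
  have "parent_maps {r} r = {id}"
    by (auto simp: parent_maps_def fun_eq_iff)
  then show ?thesis by simp
qed

section \<open>Records of a parent map\<close>

definition map_records :: "'a::linorder set \<Rightarrow> ('a \<Rightarrow> 'a) \<Rightarrow> 'a set" where
  "map_records V f = {v \<in> V. \<forall>i. (f ^^ i) v \<le> v}"

lemma finite_map_records: "finite V \<Longrightarrow> finite (map_records V f)"
  by (simp add: map_records_def)

lemma root_in_map_records: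
  assumes "f \<in> parent_maps V r"
  shows "r \<in> map_records V f"
  using parent_mapsD(1,4) [OF assms] funpow_fixpoint [of f r] by (simp add: map_records_def)

lemma max_in_map_records:
  assumes "f \<in> parent_maps V r" "m \<in> V" "\<forall>x\<in>V. x \<le> m"
  shows "m \<in> map_records V f"
  using assms funpow_in_verts [OF assms(1,2)] by (simp add: map_records_def)

text \<open>Every vertex has the root \<open>m\<close> among its iterates, so a record is at least
  \<open>m\<close>.\<close>

lemma map_records_root_max:
  assumes f: "f \<in> parent_maps V m" and m: "\<forall>x\<in>V. x \<le> m"
  shows "map_records V f = {m}"
proof -
  have "v = m" if v: "v \<in> map_records V f" for v
  proof -
    obtain i where "(f ^^ i) v = m"
      using v parent_mapsD(5) [OF f, of v] by (auto simp: map_records_def)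
    then have "m \<le> v"
      using v unfolding map_records_def by blast
    moreover have "v \<le> m"
      using v m by (simp add: map_records_def)
    ultimately show ?thesis by simp
  qed
  with root_in_map_records [OF f] show ?thesis by blast
qed

text \<open>The root and the maximum are always records, so a single record forces them to
  coincide.\<close>

lemma card_map_records_eq_1_iff:
  assumes f: "f \<in> parent_maps V r" and m: "m \<in> V" "\<forall>x\<in>V. x \<le> m"
  shows "card (map_records V f) = 1 \<longleftrightarrow> r = m"
proof
  assume "card (map_records V f) = 1"
  then show "r = m"
    using root_in_map_records [OF f] max_in_map_records [OF f m]
    by (metis card_1_singletonE singletonD)
next
  assume "r = m"
  with f m have "map_records V f = {m}"
    using map_records_root_max by metis
  then show "card (map_records V f) = 1" by simp
qed

definition record_trees :: "'a::linorder set \<Rightarrow> nat \<Rightarrow> ('a \<times> ('a \<Rightarrow> 'a)) set" where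
  "record_trees V k = {(r, f). f \<in> parent_maps V r \<and> card (map_records V f) = k}"

lemma finite_record_trees:
  assumes "finite V"
  shows "finite (record_trees V k)"
proof (rule finite_subset)
  show "record_trees V k \<subseteq> Sigma V (parent_maps V)"
    by (auto simp: record_trees_def dest: parent_mapsD(1))
  show "finite (Sigma V (parent_maps V))"
    using assms by (simp add: finite_parent_maps)
qed

lemma card_record_trees_1:
  assumes "m \<in> V" "\<forall>x\<in>V. x \<le> m"
  shows "card (record_trees V 1) = card (parent_maps V m)"
proof -
  have "record_trees V 1 = Pair m ` parent_maps V m"
    unfolding record_trees_def using card_map_records_eq_1_iff [OF _ assms] by blast
  then show ?thesis by (simp add: card_image inj_on_def)
qed

text \<open>Counts all rooted trees twice: by number of records, and by root, where every root
  contributes the same number.\<close>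

lemma sum_card_record_trees:
  assumes V: "finite V" and s: "s \<in> V"
  shows "(\<Sum>k=1..card V. card (record_trees V k)) = card V * card (parent_maps V s)"
proof -
  have bounds: "card (map_records V f) \<in> {1..card V}" if "f \<in> parent_maps V r" for f r
  proof -
    have "map_records V f \<noteq> {}" "map_records V f \<subseteq> V"
      using root_in_map_records [OF that] by (auto simp: map_records_def)
    then show ?thesis
      using V by (auto simp: card_mono Suc_le_eq card_gt_0_iff finite_map_records)
  qed
  have "(\<Sum>k=1..card V. card (record_trees V k)) = card (\<Union>k\<in>{1..card V}. record_trees V k)"
    by (rule card_UN_disjoint [symmetric]) (auto simp: finite_record_trees V, auto simp: record_trees_def)
  also have "(\<Union>k\<in>{1..card V}. record_trees V k) = Sigma V (parent_maps V)"
    unfolding record_trees_def using bounds parent_mapsD(1) by fast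
  also have "card \<dots> = (\<Sum>r\<in>V. card (parent_maps V r))"
    using V by (simp add: finite_parent_maps)
  also have "\<dots> = (\<Sum>r\<in>V. card (parent_maps V s))"
    by (rule sum.cong) (auto intro: card_parent_maps_root_indep s)
  finally show ?thesis by simp
qed

section \<open>Cutting below the largest label\<close>

text \<open>\<open>h\<close> lives on the part \<open>A\<close> that contains the root,
  \<open>g\<close> on the part hanging from \<open>m\<close>, and \<open>p\<close> is the new parent
  of \<open>m\<close>. Vertices outside both parts fall to \<open>g\<close>, which fixes them when
  it is a parent map.\<close>

definition graft :: "'a \<Rightarrow> 'a set \<Rightarrow> ('a \<Rightarrow> 'a) \<Rightarrow> ('a \<Rightarrow> 'a) \<Rightarrow> 'a \<Rightarrow> 'a \<Rightarrow> 'a" where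
  "graft m A g h p x = (if x = m then p else if x \<in> A then h x else g x)"

lemma graft_funpow_lower:
  assumes h: "h \<in> parent_maps A r" and m: "m \<notin> A" and x: "x \<in> A"
  shows "(graft m A g h p ^^ i) x = (h ^^ i) x"
proof (induction i)
  case (Suc i)
  moreover have "(h ^^ i) x \<in> A"
    using funpow_in_verts [OF h x] .
  ultimately show ?case
    using m by (auto simp: graft_def)
qed simp

text \<open>The graft follows \<open>g\<close> until \<open>m\<close> is met. There \<open>g\<close>
  stays while the graft moves on to \<open>p\<close>, so the number \<open>j\<close> of steps may be
  smaller than for \<open>g\<close>.\<close>

lemma graft_funpow_upper:
  assumes g: "g \<in> parent_maps B m" and AB: "A \<inter> B = {}" and x: "x \<in> B"
  shows "\<exists>j. (graft m A g h p ^^ j) x = m"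
proof -
  have "\<exists>j. (graft m A g h p ^^ j) x = m" if "(g ^^ i) x = m" for i
    using that x
  proof (induction i arbitrary: x)
    case 0
    then show ?case by (intro exI [of _ 0]) simp
  next
    case (Suc i)
    show ?case
    proof (cases "x = m")
      case True
      then show ?thesis by (intro exI [of _ 0]) simp
    next
      case False
      have "(g ^^ i) (g x) = m" "g x \<in> B"
        using Suc.prems parent_mapsD(2) [OF g] by (simp_all add: funpow_swap1)
      then obtain j where "(graft m A g h p ^^ j) (g x) = m"
        using Suc.IH by blast
      moreover have "graft m A g h p x = g x"
        using False AB Suc.prems(2) by (auto simp: graft_def)
      ultimately have "(graft m A g h p ^^ Suc j) x = m"
        by (simp add: funpow_swap1)
      then show ?thesis by blast
    qed
  qed
  then show ?thesis
    using parent_mapsD(5) [OF g x] by blast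
qed

lemma graft_parent_maps:
  assumes g: "g \<in> parent_maps B m" and h: "h \<in> parent_maps A r" and AB: "A \<inter> B = {}"
    and p: "p \<in> A"
  shows "graft m A g h p \<in> parent_maps (A \<union> B) r"
proof -
  let ?F = "graft m A g h p"
  have m: "m \<in> B" "m \<notin> A"
    using parent_mapsD(1) [OF g] AB by auto
  have reach_lower: "\<exists>i. (?F ^^ i) x = r" if "x \<in> A" for x
    using parent_mapsD(5) [OF h that] by (simp add: graft_funpow_lower [OF h m(2) that])
  have reach: "\<exists>i. (?F ^^ i) x = r" if x: "x \<in> A \<union> B" for x
  proof (cases "x \<in> A")
    case False
    with x have "x \<in> B" by simp
    from graft_funpow_upper [OF g AB this] obtain j where j: "(?F ^^ j) x = m" by blast
    obtain i where "(?F ^^ i) p = r" using reach_lower [OF p] by blast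
    moreover have "?F m = p" by (simp add: graft_def)
    ultimately have "(?F ^^ (i + Suc j)) x = r"
      by (simp only: funpow_add o_apply funpow.simps j)
    then show ?thesis by blast
  qed (rule reach_lower)
  have "?F x \<in> A \<union> B" if "x \<in> A \<union> B" for x
    using that p parent_mapsD(2) [OF g, of x] parent_mapsD(2) [OF h, of x]
    by (auto simp: graft_def)
  moreover have "?F x = x" if "x \<notin> A \<union> B" for x
    using that m parent_mapsD(3) [OF g, of x] by (auto simp: graft_def)
  moreover have "r \<in> A" "?F r = r"
    using parent_mapsD(1,4) [OF h] m by (auto simp: graft_def)
  ultimately show ?thesis
    using reach by (auto simp: parent_maps_def)
qed

text \<open>The path of a vertex of \<open>B\<close> passes through the maximum \<open>m\<close>, so
  only \<open>m\<close> itself can be a record there; on \<open>A\<close> the iterates are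
  unchanged.\<close>

lemma graft_map_records:
  assumes g: "g \<in> parent_maps B m" and h: "h \<in> parent_maps A r" and AB: "A \<inter> B = {}"
    and p: "p \<in> A" and max: "\<forall>x\<in>A \<union> B. x \<le> m"
  shows "map_records (A \<union> B) (graft m A g h p) = insert m (map_records A h)"
proof -
  let ?F = "graft m A g h p"
  have m: "m \<in> B" "m \<notin> A"
    using parent_mapsD(1) [OF g] AB by auto
  have "x = m" if x: "x \<in> B" and rec: "x \<in> map_records (A \<union> B) ?F" for x
  proof (rule antisym)
    show "x \<le> m" using max x by simp
    obtain j where "(?F ^^ j) x = m"
      using graft_funpow_upper [OF g AB x] by blast
    moreover have "(?F ^^ j) x \<le> x"
      using rec by (simp add: map_records_def)
    ultimately show "m \<le> x" by simp
  qed
  moreover have "m \<in> map_records (A \<union> B) ?F"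
    by (rule max_in_map_records [OF graft_parent_maps [OF g h AB p] _ max]) (use m in simp)
  moreover have "x \<in> map_records (A \<union> B) ?F \<longleftrightarrow> x \<in> map_records A h" if "x \<in> A" for x
    using that by (simp add: map_records_def graft_funpow_lower [OF h m(2)])
  moreover have "map_records (A \<union> B) ?F \<subseteq> A \<union> B" "map_records A h \<subseteq> A"
    by (auto simp: map_records_def)
  ultimately show ?thesis by blast
qed

section \<open>Undoing a graft\<close>

text \<open>Recovers the part \<open>A\<close> from the whole map. The iterate \<open>i = 0\<close>
  excludes \<open>m\<close> itself, which thus belongs to the part cut off.\<close>

definition non_descendants :: "'a set \<Rightarrow> 'a \<Rightarrow> ('a \<Rightarrow> 'a) \<Rightarrow> 'a set" where
  "non_descendants V m f = {x \<in> V. \<forall>i. (f ^^ i) x \<noteq> m}"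

lemma non_descendants_step:
  assumes f: "f \<in> parent_maps V r" and x: "x \<in> V" "x \<noteq> m"
  shows "f x \<in> non_descendants V m f \<longleftrightarrow> x \<in> non_descendants V m f"
proof -
  have "(\<forall>i. (f ^^ i) x \<noteq> m) \<longleftrightarrow> (\<forall>i. (f ^^ i) (f x) \<noteq> m)"
  proof
    assume "\<forall>i. (f ^^ i) x \<noteq> m"
    then show "\<forall>i. (f ^^ i) (f x) \<noteq> m"
      by (metis funpow_simps_right(2) o_apply)
  next
    assume "\<forall>i. (f ^^ i) (f x) \<noteq> m"
    then have "(f ^^ i) x \<noteq> m" for i
      using x(2) by (cases i) (auto simp: funpow_swap1)
    then show "\<forall>i. (f ^^ i) x \<noteq> m" by blast
  qed
  with x parent_mapsD(2) [OF f x(1)] show ?thesis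
    by (simp add: non_descendants_def)
qed

lemma non_descendants_root:
  assumes f: "f \<in> parent_maps V r" and "r \<noteq> m"
  shows "r \<in> non_descendants V m f"
  using assms(2) parent_mapsD(1,4) [OF f] funpow_fixpoint [of f r] by (simp add: non_descendants_def)

text \<open>A path from \<open>f m\<close> back to \<open>m\<close> would make \<open>m\<close>
  periodic, hence the root.\<close>

lemma non_descendants_parent:
  assumes f: "f \<in> parent_maps V r" and m: "m \<in> V" "m \<noteq> r"
  shows "f m \<in> non_descendants V m f"
proof -
  have "(f ^^ i) (f m) \<noteq> m" for i
    using parent_maps_periodic [OF f m(1), of "Suc i"] m(2) by (auto simp: funpow_swap1)
  then show ?thesis
    using parent_mapsD(2) [OF f m(1)] by (simp add: non_descendants_def)
qed

lemma restrict_lower_parent_maps: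
  assumes f: "f \<in> parent_maps V r" and r: "r \<noteq> m"
  defines "A \<equiv> non_descendants V m f"
  shows "(\<lambda>x. if x \<in> A then f x else x) \<in> parent_maps A r"
proof -
  let ?h = "\<lambda>x. if x \<in> A then f x else x"
  have AV: "x \<in> V" "x \<noteq> m" if "x \<in> A" for x
    using that by (auto simp: A_def non_descendants_def dest: spec [of _ 0])
  have closed: "f x \<in> A" if "x \<in> A" for x
    using non_descendants_step [OF f AV [OF that]] that by (simp add: A_def)
  have fp: "(?h ^^ i) x = (f ^^ i) x \<and> (f ^^ i) x \<in> A" if "x \<in> A" for x i
    by (induction i) (use that closed in auto)
  have "\<exists>i. (?h ^^ i) x = r" if "x \<in> A" for x
    using parent_mapsD(5) [OF f AV(1) [OF that]] fp [OF that] by metis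
  then show ?thesis
    using non_descendants_root [OF f r] closed parent_mapsD(4) [OF f]
    by (auto simp: parent_maps_def A_def)
qed

lemma restrict_upper_parent_maps:
  assumes f: "f \<in> parent_maps V r" and m: "m \<in> V"
  defines "B \<equiv> V - non_descendants V m f"
  shows "(\<lambda>x. if x \<in> B \<and> x \<noteq> m then f x else x) \<in> parent_maps B m"
proof -
  let ?g = "\<lambda>x. if x \<in> B \<and> x \<noteq> m then f x else x"
  have mB: "m \<in> B"
    using m by (auto simp: B_def non_descendants_def intro: exI [of _ 0])
  have closed: "f x \<in> B" if "x \<in> B" "x \<noteq> m" for x
    using non_descendants_step [OF f _ that(2)] that parent_mapsD(2) [OF f, of x] by (auto simp: B_def)
  \<comment> \<open>The restricted map stops at \<open>m\<close> where \<open>f\<close> goes on, so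
    the exponent is again left open.\<close>
  have "\<exists>j. (?g ^^ j) x = m" if "(f ^^ i) x = m" "x \<in> B" for i x
    using that
  proof (induction i arbitrary: x)
    case 0
    then show ?case by (intro exI [of _ 0]) simp
  next
    case (Suc i)
    show ?case
    proof (cases "x = m")
      case True
      then show ?thesis by (intro exI [of _ 0]) simp
    next
      case False
      then obtain j where "(?g ^^ j) (f x) = m"
        using Suc.IH [of "f x"] Suc.prems closed by (auto simp: funpow_swap1)
      moreover have "?g x = f x" using False Suc.prems by simp
      ultimately have "(?g ^^ Suc j) x = m"
        by (simp only: funpow_simps_right(2) o_apply)
      then show ?thesis by blast
    qed
  qed
  moreover have "\<exists>i. (f ^^ i) x = m" if "x \<in> B" for x
    using that by (auto simp: B_def non_descendants_def)
  ultimately have "\<exists>j. (?g ^^ j) x = m" if "x \<in> B" for x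
    using that by blast
  then show ?thesis
    using mB closed by (auto simp: parent_maps_def)
qed


text \<open>Orbits starting in \<open>A\<close> stay in \<open>A\<close> and avoid \<open>m\<close>,
  all others in \<open>V\<close> run into \<open>m\<close>. Hence the graft determines
  \<open>A\<close>, the starting point for its injectivity.\<close>

lemma non_descendants_graft:
  assumes A: "A \<subseteq> V" and g: "g \<in> parent_maps (V - A) m" and h: "h \<in> parent_maps A r"
  shows "non_descendants V m (graft m A g h p) = A"
proof -
  have m: "m \<notin> A" using parent_mapsD(1) [OF g] by simp
  have "(graft m A g h p ^^ i) x \<noteq> m" if "x \<in> A" for x i
    using funpow_in_verts [OF h that, of i] m by (auto simp: graft_funpow_lower [OF h m that])
  moreover have "\<exists>i. (graft m A g h p ^^ i) x = m" if "x \<in> V - A" for x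
    by (rule graft_funpow_upper [OF g _ that]) blast
  ultimately show ?thesis
    using A unfolding non_descendants_def by blast
qed

lemma graft_inject:
  assumes A: "A \<subseteq> V" and g: "g \<in> parent_maps (V - A) m" and h: "h \<in> parent_maps A r"
    and A': "A' \<subseteq> V" and g': "g' \<in> parent_maps (V - A') m" and h': "h' \<in> parent_maps A' r'"
    and eq: "graft m A g h p = graft m A' g' h' p'"
  shows "A = A' \<and> g = g' \<and> h = h' \<and> p = p'"
proof -
  have AA: "A = A'"
    using non_descendants_graft [OF A g h, of p] non_descendants_graft [OF A' g' h', of p'] eq by simp
  have m: "m \<notin> A" using parent_mapsD(1) [OF g] by simp
  have eq_x: "graft m A g h p x = graft m A g' h' p' x" for x
    using eq AA by simp
  have "g x = g' x" for x
  proof (cases "x \<in> V - A")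
    case True
    \<comment> \<open>At \<open>x = m\<close> the graft shows \<open>p\<close> instead of
      \<open>g m\<close>, but \<open>m\<close> is the root of both \<open>g\<close> and
      \<open>g'\<close> and so is fixed by both.\<close>
    then show ?thesis
      using eq_x [of x] parent_mapsD(4) [OF g] parent_mapsD(4) [OF g']
      by (auto simp: graft_def split: if_splits)
  next
    case False
    then show ?thesis
      using parent_mapsD(3) [OF g] parent_mapsD(3) [OF g'] AA by auto
  qed
  moreover have "h x = h' x" for x
  proof (cases "x \<in> A")
    case True
    then show ?thesis
      using eq_x [of x] m by (auto simp: graft_def split: if_splits)
  next
    case False
    then show ?thesis
      using parent_mapsD(3) [OF h] parent_mapsD(3) [OF h'] AA by auto
  qed
  moreover have "p = p'"
    using eq_x [of m] by (simp add: graft_def)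
  ultimately show ?thesis
    using AA by blast
qed

lemma graft_restrict:
  assumes f: "f \<in> parent_maps V r" and m: "m \<in> V"
  defines "A \<equiv> non_descendants V m f"
  shows "graft m A (\<lambda>x. if x \<in> V - A \<and> x \<noteq> m then f x else x) (\<lambda>x. if x \<in> A then f x else x) (f m) = f"
    (is "?F = f")
proof
  fix x
  have "A \<subseteq> V" by (auto simp: A_def non_descendants_def)
  then show "?F x = f x"
    using parent_mapsD(3) [OF f, of x] by (auto simp: graft_def)
qed

text \<open>A tree with at least two records is not rooted at \<open>m\<close>, so it can be cut
  above \<open>m\<close>. The inverse takes \<open>A\<close> to be the non-descendants of
  \<open>m\<close> and restricts the map to both parts.\<close>

lemma bij_betw_graft:
  assumes V: "finite V" and m: "m \<in> V" "\<forall>x\<in>V. x \<le> m" and k: "k \<ge> 1"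
  shows "bij_betw (\<lambda>(A, g, (r, h), p). (r, graft m A g h p))
    (SIGMA A:Pow (V - {m}). parent_maps (V - A) m \<times> record_trees A k \<times> A)
    (record_trees V (Suc k))"
    (is "bij_betw ?G ?S ?T")
proof (rule bij_betw_imageI)
  show "inj_on ?G ?S"
  proof (rule inj_onI)
    fix x y assume xy: "x \<in> ?S" "y \<in> ?S" "?G x = ?G y"
    obtain A g r h p where x: "x = (A, g, (r, h), p)" by (cases x) auto
    obtain A' g' r' h' p' where y: "y = (A', g', (r', h'), p')" by (cases y) auto
    have "A \<subseteq> V" "g \<in> parent_maps (V - A) m" "h \<in> parent_maps A r"
      "A' \<subseteq> V" "g' \<in> parent_maps (V - A') m" "h' \<in> parent_maps A' r'"
      and eq: "r = r'" "graft m A g h p = graft m A' g' h' p'"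
      using xy by (auto simp: x y record_trees_def)
    from graft_inject [OF this(1-6) eq(2)] eq(1) show "x = y"
      by (simp add: x y)
  qed
  show "?G ` ?S = ?T"
  proof (intro equalityI subsetI)
    fix t assume "t \<in> ?G ` ?S"
    then obtain A g r h p where A: "A \<subseteq> V - {m}" and g: "g \<in> parent_maps (V - A) m"
      and h: "h \<in> parent_maps A r" and hk: "card (map_records A h) = k" and p: "p \<in> A"
      and t: "t = (r, graft m A g h p)"
      by (auto simp: record_trees_def)
    have AV: "A \<inter> (V - A) = {}" "A \<union> (V - A) = V" using A by auto
    \<comment> \<open>As \<open>m\<close> lies outside \<open>A\<close>, inserting it raises the
      number of records by exactly one.\<close>
    have "m \<notin> map_records A h" using A by (auto simp: map_records_def)
    moreover have "finite (map_records A h)"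
      using A V by (meson finite_Diff finite_map_records finite_subset)
    ultimately have "card (map_records V (graft m A g h p)) = Suc k"
      using graft_map_records [OF g h AV(1) p, unfolded AV(2)] m hk by simp
    moreover have "graft m A g h p \<in> parent_maps V r"
      using graft_parent_maps [OF g h AV(1) p, unfolded AV(2)] by simp
    ultimately show "t \<in> ?T"
      by (simp add: t record_trees_def)
  next
    fix t assume "t \<in> ?T"
    then obtain r f where t: "t = (r, f)" and f: "f \<in> parent_maps V r"
      and card: "card (map_records V f) = Suc k"
      by (auto simp: record_trees_def)
    have r: "r \<noteq> m"
      using map_records_root_max [of f V m] f m(2) card k by auto
    define A where "A = non_descendants V m f"
    define g where "g = (\<lambda>x. if x \<in> V - A \<and> x \<noteq> m then f x else x)"
    define h where "h = (\<lambda>x. if x \<in> A then f x else x)"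
    have A: "A \<subseteq> V - {m}"
      by (auto simp: A_def non_descendants_def dest: spec [of _ 0])
    have g: "g \<in> parent_maps (V - A) m"
      unfolding g_def A_def by (rule restrict_upper_parent_maps [OF f m(1)])
    have h: "h \<in> parent_maps A r"
      unfolding h_def A_def by (rule restrict_lower_parent_maps [OF f r])
    have p: "f m \<in> A"
      unfolding A_def by (rule non_descendants_parent [OF f m(1)]) (use r in simp)
    have f_eq: "graft m A g h (f m) = f"
      unfolding g_def h_def A_def by (rule graft_restrict [OF f m(1)])
    have AV: "A \<inter> (V - A) = {}" "A \<union> (V - A) = V" using A by auto
    have "m \<notin> map_records A h" using A by (auto simp: map_records_def)
    moreover have "finite (map_records A h)"
      using A V by (meson finite_Diff finite_map_records finite_subset)
    moreover have "map_records V f = insert m (map_records A h)"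
      using graft_map_records [OF g h AV(1) p, unfolded AV(2)] m by (simp add: f_eq)
    ultimately have "card (map_records A h) = k"
      using card by simp
    then have "(A, g, (r, h), f m) \<in> ?S"
      using A g h p by (simp add: record_trees_def)
    then show "t \<in> ?G ` ?S"
      by (rule rev_image_eqI) (simp add: t f_eq)
  qed
qed

section \<open>Counting by induction on the number of vertices\<close>

lemma card_record_trees_Suc:
  assumes V: "finite V" and m: "m \<in> V" "\<forall>x\<in>V. x \<le> m" and k: "k \<ge> 1"
  shows "card (record_trees V (Suc k)) =
    (\<Sum>A\<in>Pow (V - {m}). card (parent_maps (V - A) m) * (card (record_trees A k) * card A))"
proof -
  have "card (record_trees V (Suc k)) =
      card (SIGMA A:Pow (V - {m}). parent_maps (V - A) m \<times> record_trees A k \<times> A)"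
    by (rule bij_betw_same_card [OF bij_betw_graft [OF assms], symmetric])
  also have "\<dots> = (\<Sum>A\<in>Pow (V - {m}). card (parent_maps (V - A) m \<times> record_trees A k \<times> A))"
  proof (rule card_SigmaI)
    show "\<forall>A\<in>Pow (V - {m}). finite (parent_maps (V - A) m \<times> record_trees A k \<times> A)"
    proof
      fix A assume "A \<in> Pow (V - {m})"
      then have "finite A" using V by (auto intro: finite_subset)
      then show "finite (parent_maps (V - A) m \<times> record_trees A k \<times> A)"
        using V by (simp add: finite_parent_maps finite_record_trees)
    qed
  qed (use V in simp)
  finally show ?thesis by (simp add: card_cartesian_product)
qed

lemma sum_Pow_card:
  fixes \<phi> :: "nat \<Rightarrow> real"
  assumes "finite W"
  shows "(\<Sum>A\<in>Pow W. \<phi> (card A)) = (\<Sum>a\<le>card W. real (card W choose a) * \<phi> a)"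
proof -
  have "(\<Sum>A\<in>Pow W. \<phi> (card A)) = (\<Sum>a\<le>card W. \<Sum>A | A \<in> Pow W \<and> card A = a. \<phi> (card A))"
    by (rule sum.group [symmetric]) (use assms in \<open>auto simp: card_mono\<close>)
  also have "\<dots> = (\<Sum>a\<le>card W. real (card W choose a) * \<phi> a)"
    by (rule sum.cong) (use assms in \<open>auto simp: n_subsets\<close>)
  finally show ?thesis .
qed

text \<open>The two counts need each other. For at least two records both parts of the cut are
  smaller, so the induction hypothesis supplies both counts; the number of trees rooted at the
  maximum is then the only unknown in the total.\<close>

lemma card_parent_maps_record_trees:
  assumes "finite V" "V \<noteq> {}"
  shows "real (card (parent_maps V (Max V))) = abel_poly (card V - 1) 1"
    and "k \<ge> 1 \<Longrightarrow> real (card (record_trees V k)) = record_count (card V) k"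
proof -
  have "real (card (parent_maps V (Max V))) = abel_poly (card V - 1) 1 \<and>
    (\<forall>k\<ge>1. real (card (record_trees V k)) = record_count (card V) k)"
    using assms
  proof (induction "card V" arbitrary: V rule: less_induct)
    case less
    define m n where "m = Max V" and "n = card V - 1"
    have m: "m \<in> V" "\<forall>x\<in>V. x \<le> m"
      using less.prems by (auto simp: m_def)
    have card_V: "card V = Suc n" "card (V - {m}) = n"
      using less.prems m(1) by (auto simp: n_def card_gt_0_iff)
    have large: "real (card (record_trees V (Suc k))) = record_count (card V) (Suc k)"
      if k: "k \<ge> 1" for k
    proof -
      have "real (card (parent_maps (V - A) m) * (card (record_trees A k) * card A)) =
          abel_poly (n - card A) 1 * record_count (card A) k * real (card A)"
        if A: "A \<in> Pow (V - {m})" for A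
      \<comment> \<open>For empty \<open>A\<close> the factor \<open>card A\<close> makes both sides
        zero; otherwise \<open>V - A\<close> and \<open>A\<close> are both nonempty and smaller than
        \<open>V\<close>.\<close>
      proof (cases "A = {}")
        case False
        have fin: "finite A" using A less.prems by (auto intro: finite_subset)
        have "card A \<le> n"
          using A card_mono [of "V - {m}" A] less.prems card_V by auto
        have "card A > 0" using False fin by (simp add: card_gt_0_iff)
        have card_B: "card (V - A) = Suc (n - card A)"
          using A fin \<open>card A \<le> n\<close> card_V(1) by (subst card_Diff_subset) auto
        have "Max (V - A) = m"
          by (rule Max_eqI) (use A m less.prems in auto)
        then have "real (card (parent_maps (V - A) m)) = abel_poly (n - card A) 1"
          using less.hyps [of "V - A"] card_B card_V(1) \<open>card A > 0\<close> \<open>card A \<le> n\<close> less.prems(1)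
            A m(1) by auto
        moreover have "real (card (record_trees A k)) = record_count (card A) k"
          using less.hyps [of A] \<open>card A \<le> n\<close> card_V(1) fin False k by simp
        ultimately show ?thesis by simp
      qed simp
      then have "real (card (record_trees V (Suc k))) =
          (\<Sum>A\<in>Pow (V - {m}). abel_poly (n - card A) 1 * record_count (card A) k * real (card A))"
        unfolding card_record_trees_Suc [OF less.prems(1) m k] of_nat_sum by (rule sum.cong [OF refl])
      also have "\<dots> = record_count (card V) (Suc k)"
        using sum_Pow_card [of "V - {m}" "\<lambda>a. abel_poly (n - a) 1 * record_count a k * real a"]
          record_count_rec [OF k, of n] less.prems(1) card_V by simp
      finally show ?thesis .
    qed
    define t where "t = real (card (parent_maps V m))"
    have small: "real (card (record_trees V 1)) = t"
      using card_record_trees_1 [OF m] by (simp add: t_def)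
    have t: "t = abel_poly n 1"
    \<comment> \<open>The equation for \<open>t\<close> below gets divided by \<open>n\<close>, so a
      single vertex is treated directly.\<close>
    proof (cases "n = 0")
      case True
      then have "V = {m}" using card_V m(1) by (metis One_nat_def card_1_singletonE singletonD)
      then show ?thesis using True by (simp add: t_def card_parent_maps_singleton)
    next
      case False
      have split: "(\<Sum>k=1..Suc n. F k) = F 1 + (\<Sum>k=1..n. F (Suc k))" for F :: "nat \<Rightarrow> real"
        by (simp add: sum.atLeast_Suc_atMost sum.shift_bounds_cl_Suc_ivl del: sum.cl_ivl_Suc)
      \<comment> \<open>With \<open>N = n + 1\<close>, the total \<open>N * t\<close> equals
        \<open>t\<close>, for one record, plus \<open>N^n - N^(n-1)\<close>, for at least two;
        solving gives \<open>t = N^(n-1)\<close>.\<close>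
      have "real (Suc n) * t = (\<Sum>k=1..Suc n. real (card (record_trees V k)))"
        using sum_card_record_trees [OF less.prems(1) m(1)] card_V(1)
        by (simp add: t_def flip: of_nat_sum of_nat_mult del: of_nat_Suc)
      also have "\<dots> = t + (\<Sum>k=1..n. record_count (Suc n) (Suc k))"
        unfolding split small using large card_V(1) by (simp del: of_nat_Suc)
      also have "(\<Sum>k=1..n. record_count (Suc n) (Suc k)) = real (Suc n) ^ n - record_count (Suc n) 1"
        using sum_record_count [of "Suc n"] split [of "record_count (Suc n)"] by simp
      also have "record_count (Suc n) 1 = real (Suc n) ^ (n - 1)"
        using False by (simp add: record_count_def abel_poly_def)
      also have "real (Suc n) ^ n = real (Suc n) * real (Suc n) ^ (n - 1)"
        using False by (metis Suc_pred' neq0_conv power_Suc)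
      finally have "real n * t = real n * real (Suc n) ^ (n - 1)"
        by (simp add: algebra_simps)
      then show ?thesis
        using False by (simp add: abel_poly_def)
    qed
    have "real (card (record_trees V k)) = record_count (card V) k" if "k \<ge> 1" for k
    proof (cases "k = 1")
      case True
      then show ?thesis
        using small t card_V(1) by (simp add: record_count_def)
    next
      case False
      with that show ?thesis using large [of "k - 1"] by simp
    qed
    with t show ?case
      by (simp add: t_def m_def n_def)
  qed
  then show "real (card (parent_maps V (Max V))) = abel_poly (card V - 1) 1"
    and "k \<ge> 1 \<Longrightarrow> real (card (record_trees V k)) = record_count (card V) k"
    by auto
qed

section \<open>Trees as graphs of parent maps\<close>

lemma (in pair_wf_digraph) awalk_nth_arc:
  assumes "awalk u p w" "i < length p"
  shows "(pawalk_verts u p ! i, pawalk_verts u p ! Suc i) \<in> parcs G"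
  using assms
proof (induction p arbitrary: u i)
  case (Cons e p)
  have "awalk (snd e) p w" "e \<in> parcs G"
    using Cons.prems by (auto simp: awalk_Cons_iff)
  moreover from this(1) have "pawalk_verts (snd e) p ! 0 = snd e"
    by (cases p) (auto simp: awalk_Cons_iff)
  ultimately show ?case
    using Cons by (cases i) auto
qed simp

text \<open>Each edge appears in both directions, and \<open>x \<noteq> y\<close> removes the loop
  that a fixed root would create.\<close>

definition parent_graph :: "'a set \<Rightarrow> ('a \<Rightarrow> 'a) \<Rightarrow> 'a pair_pre_digraph" where
  "parent_graph V f =
    \<lparr>pverts = V, parcs = {(x, y). x \<in> V \<and> y \<in> V \<and> x \<noteq> y \<and> (y = f x \<or> x = f y)}\<rparr>"

lemma pverts_parent_graph [simp]: "pverts (parent_graph V f) = V"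
  by (simp add: parent_graph_def)

lemma parcs_parent_graph_iff:
  "(x, y) \<in> parcs (parent_graph V f) \<longleftrightarrow> x \<in> V \<and> y \<in> V \<and> x \<noteq> y \<and> (y = f x \<or> x = f y)"
  by (simp add: parent_graph_def)

lemma pair_graph_parent_graph:
  assumes "finite V"
  shows "pair_graph (parent_graph V f)"
proof unfold_locales
  show "finite (parcs (parent_graph V f))"
    by (rule finite_subset [of _ "V \<times> V"]) (use assms in \<open>auto simp: parent_graph_def\<close>)
  show "symmetric (with_proj (parent_graph V f))"
    by (auto simp: symmetric_def parent_graph_def intro!: symI)
qed (use assms in \<open>auto simp: parent_graph_def\<close>)

context
  fixes V :: "'a set" and r :: 'a and f :: "'a \<Rightarrow> 'a"
  assumes V: "finite V" and f: "f \<in> parent_maps V r"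
begin

interpretation G: pair_graph "parent_graph V f"
  by (rule pair_graph_parent_graph [OF V])

lemma parent_graph_awalk_to_root:
  assumes "v \<in> V"
  shows "\<exists>p. G.awalk v p r \<and> set (pawalk_verts v p) \<subseteq> range (\<lambda>i. (f ^^ i) v)"
proof -
  have "\<exists>p. G.awalk v p r \<and> set (pawalk_verts v p) \<subseteq> range (\<lambda>i. (f ^^ i) v)"
    if "(f ^^ i) v = r" for i
    using that assms
  proof (induction i arbitrary: v)
    case 0
    then have "G.awalk v [] r" by (simp add: G.awalk_Nil_iff)
    moreover have "v \<in> range (\<lambda>i. (f ^^ i) v)"
      by (rule range_eqI [of _ _ 0]) simp
    ultimately show ?case by (intro exI [of _ "[]"]) simp
  next
    case (Suc i)
    have v_range: "v \<in> range (\<lambda>i. (f ^^ i) v)"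
      by (rule range_eqI [of _ _ 0]) simp
    show ?case
    proof (cases "f v = v")
      \<comment> \<open>A fixed point gives no arc to follow, but it can only be the root, where the
        empty walk suffices.\<close>
      case True
      then have "v = r"
        using Suc.prems(1) funpow_fixpoint [of f v "Suc i"] by simp
      then have "G.awalk v [] r" using Suc.prems(2) by (simp add: G.awalk_Nil_iff)
      then show ?thesis using v_range by (intro exI [of _ "[]"]) simp
    next
      case False
      have "(f ^^ i) (f v) = r" "f v \<in> V"
        using Suc.prems parent_mapsD(2) [OF f] by (simp_all add: funpow_swap1)
      then obtain p where p: "G.awalk (f v) p r"
        "set (pawalk_verts (f v) p) \<subseteq> range (\<lambda>i. (f ^^ i) (f v))"
        using Suc.IH by blast
      have "G.awalk v ((v, f v) # p) r"
        using p(1) False Suc.prems(2) \<open>f v \<in> V\<close>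
        by (simp add: G.awalk_Cons_iff parcs_parent_graph_iff)
      moreover have "range (\<lambda>i. (f ^^ i) (f v)) \<subseteq> range (\<lambda>i. (f ^^ i) v)"
      proof (rule image_subsetI)
        fix i
        show "(f ^^ i) (f v) \<in> range (\<lambda>i. (f ^^ i) v)"
          by (rule range_eqI [of _ _ "Suc i"]) (simp add: funpow_swap1)
      qed
      ultimately show ?thesis
        using p(2) v_range by (intro exI [of _ "(v, f v) # p"]) auto
    qed
  qed
  then show ?thesis
    using parent_mapsD(5) [OF f assms] by blast
qed

text \<open>If the first arc leads to the parent, the later iterates lie on the rest of the walk; if
  it leads to a child \<open>x\<close>, all iterates of \<open>v\<close> are iterates of
  \<open>x\<close> already.\<close>

lemma parent_graph_awalk_contains_iterates:
  assumes "G.awalk v p r"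
  shows "(f ^^ i) v \<in> set (pawalk_verts v p)"
  using assms
proof (induction p arbitrary: v i)
  case Nil
  then show ?case
    using funpow_fixpoint [of f r i] parent_mapsD(4) [OF f] by (simp add: G.awalk_Nil_iff)
next
  case (Cons e p)
  obtain x where e: "e = (v, x)" and arc: "(v, x) \<in> parcs (parent_graph V f)"
    and p: "G.awalk x p r"
    using Cons.prems by (cases e) (auto simp: G.awalk_Cons_iff)
  from arc consider "x = f v" | "v = f x"
    by (auto simp: parcs_parent_graph_iff)
  then show ?case
  proof cases
    case 1
    then show ?thesis
      using Cons.IH [OF p] by (cases i) (auto simp: e funpow_swap1)
  next
    case 2
    have "(f ^^ i) v = (f ^^ Suc i) x"
      by (simp add: 2 funpow_swap1)
    then show ?thesis
      using Cons.IH [OF p, of "Suc i"] by (simp add: e)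
  qed
qed

lemma parent_graph_connected: "Digraph_Component.connected (with_proj (parent_graph V f))"
proof -
  have to_root: "u \<rightarrow>\<^sup>*\<^bsub>parent_graph V f\<^esub> r" if "u \<in> V" for u
    using parent_graph_awalk_to_root [OF that] by (auto simp: G.reachable_awalk)
  then have "u \<rightarrow>\<^sup>*\<^bsub>parent_graph V f\<^esub> v" if "u \<in> V" "v \<in> V" for u v
    using that G.symmetric_reachable' G.reachable_trans by blast
  then show ?thesis
    using parent_mapsD(1) [OF f]
    by (auto simp: Digraph_Component.connected_def strongly_connected_def
        G.reachable_mk_symmetric_eq [OF G.sym_arcs])
qed

text \<open>A step of a cycle away from the root cannot be followed by a step towards the root, which
  would backtrack. So either all steps go in the same direction, making the cycle a cycle
  of \<open>f\<close>, or the second and the last but one vertex of the cycle coincide.\<close>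

lemma parent_graph_no_cycle:
  assumes cycle: "G.cycle c" and l: "3 \<le> length c"
  shows False
proof -
  obtain u where u: "G.awalk u c u" and distinct: "distinct (tl (pawalk_verts u c))"
    using cycle by (auto simp: G.cycle_def)
  define l where "l = length c"
  define x where "x = (\<lambda>i. pawalk_verts u c ! i)"
  have len: "length (pawalk_verts u c) = Suc l"
    using G.length_awalk_verts by (simp add: l_def)
  have ends: "x 0 = u" "x l = u"
    using G.awalk_ends [OF u u] u len l
    by (auto simp: x_def l_def hd_conv_nth [symmetric] last_conv_nth G.awalk_conv)
  have l3: "3 \<le> l" using l by (simp add: l_def)
  \<comment> \<open>Index 0 is excluded because \<open>x 0 = x l\<close>.\<close>
  have neq: "x i \<noteq> x j" if "1 \<le> i" "i < j" "j \<le> l" for i j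
  proof -
    have "tl (pawalk_verts u c) ! (i - 1) \<noteq> tl (pawalk_verts u c) ! (j - 1)"
      using that len distinct by (subst nth_eq_iff_index_eq) auto
    then show ?thesis
      using that len by (simp add: nth_tl x_def)
  qed
  have arc: "x i \<in> V" "x i \<noteq> x (Suc i)" "x (Suc i) = f (x i) \<or> x i = f (x (Suc i))" if "i < l" for i
    using G.awalk_nth_arc [OF u, of i] that by (auto simp: x_def l_def parcs_parent_graph_iff)
  \<comment> \<open>\<open>down i\<close> says that step \<open>i\<close> leads away from the root,
    from a parent to its child.\<close>
  define down where "down i \<longleftrightarrow> x i = f (x (Suc i))" for i
  have down_Suc: "down (Suc i)" if "down i" "Suc i < l" for i
  proof (rule ccontr)
    assume "\<not> down (Suc i)"
    then have "x (Suc (Suc i)) = f (x (Suc i))"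
      using arc(3) [OF that(2)] by (simp add: down_def)
    then have backtrack: "x (Suc (Suc i)) = x i"
      using that(1) by (simp add: down_def)
    show False
    proof (cases "i = 0")
      case True
      \<comment> \<open>Backtracking at the start means \<open>x 2 = x 0 = x l\<close>, and
        \<open>2 < l\<close> since the cycle has length at least 3.\<close>
      then show False using backtrack ends neq [of 2 l] l3 by (simp add: numeral_2_eq_2)
    next
      case False
      then show False using backtrack neq [of i "Suc (Suc i)"] that(2) by simp
    qed
  qed
  have r_fix: "f r = r" using parent_mapsD(4) [OF f] .
  have x0: "x 0 \<in> V" using arc(1) [of 0] l3 by simp
  have periodic: "x 0 = r" if "(f ^^ l) (x 0) = x 0"
    by (rule parent_maps_periodic [OF f x0 _ that]) (use l3 in simp)
  \<comment> \<open>By \<open>down_Suc\<close>, the first case makes all steps lead away from the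
    root and the second makes all lead towards it. In the third, \<open>x 1\<close> and
    \<open>x (l - 1)\<close> are both the parent of \<open>u\<close>.\<close>
  consider "down 0" | "\<not> down (l - 1)" | "\<not> down 0" "down (l - 1)" by blast
  then show False
  proof cases
    case 1
    have all: "down i" if "i < l" for i
      using that by (induction i) (auto simp: 1 down_Suc)
    have "(f ^^ i) (x i) = x 0" if "i \<le> l" for i
      using that
    proof (induction i)
      case (Suc i)
      then show ?case using all [of i] by (simp add: funpow_swap1 down_def)
    qed simp
    \<comment> \<open>The starting vertex is periodic under \<open>f\<close>, hence the root; the
      last step of the cycle would then be a loop at the root.\<close>
    then have "x 0 = r" using periodic ends by force
    moreover have "x (l - 1) = f (x l)" using all [of "l - 1"] l3 by (simp add: down_def)
    ultimately show False using ends arc(2) [of "l - 1"] l3 r_fix by simp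
  next
    case 2
    have up_all: "\<not> down i" if "i < l" for i
    proof
      assume "down i"
      have "down (i + j)" if "i + j < l" for j
        using that by (induction j) (auto simp: \<open>down i\<close> down_Suc)
      from this [of "l - 1 - i"] show False using 2 \<open>i < l\<close> by simp
    qed
    have "(f ^^ i) (x 0) = x i" if "i \<le> l" for i
      using that
    proof (induction i)
      case (Suc i)
      then show ?case using up_all [of i] arc(3) [of i] by (simp add: down_def)
    qed simp
    then have "x 0 = r" using periodic ends by simp
    moreover have "x 1 = f (x 0)" using up_all [of 0] arc(3) [of 0] l3 by (simp add: down_def)
    ultimately show False using arc(2) [of 0] l3 r_fix by simp
  next
    case 3
    have "x 1 = f (x 0)" using 3 arc(3) [of 0] l3 by (simp add: down_def)
    moreover have "x (l - 1) = f (x l)" using 3(2) l3 by (simp add: down_def)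
    ultimately have "x 1 = x (l - 1)" using ends by simp
    moreover have "1 < l - 1" using l3 by linarith
    ultimately show False using neq [of 1 "l - 1"] by simp
  qed
qed

end

text \<open>Induction on the distance from the root. The edge from \<open>v\<close> to
  \<open>f v\<close> also comes from \<open>g\<close>, so \<open>g v = f v\<close> or
  \<open>g (f v) = v\<close>; as \<open>g\<close> and \<open>f\<close> agree at \<open>f v\<close>,
  the latter would give \<open>f\<close> a cycle of length 2.\<close>

lemma parent_graph_inject:
  assumes f: "f \<in> parent_maps V r" and g: "g \<in> parent_maps V r"
    and eq: "parent_graph V f = parent_graph V g"
  shows "f = g"
proof
  fix v
  have "f v = g v" if "(f ^^ i) v = r" "v \<in> V" for i
    using that
  proof (induction i arbitrary: v)
    case 0
    then show ?case using parent_mapsD(4) [OF f] parent_mapsD(4) [OF g] by simp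
  next
    case (Suc i)
    show ?case
    proof (cases "v = r")
      case True
      then show ?thesis using parent_mapsD(4) [OF f] parent_mapsD(4) [OF g] by simp
    next
      case False
      have fv: "f v \<in> V" using parent_mapsD(2) [OF f Suc.prems(2)] .
      have step: "f (f v) = g (f v)"
        by (rule Suc.IH) (use Suc.prems fv in \<open>simp_all add: funpow_swap1\<close>)
      have "f v \<noteq> v" using parent_maps_periodic [OF f Suc.prems(2), of 1] False by auto
      then have "(v, f v) \<in> parcs (parent_graph V g)"
        using Suc.prems(2) fv eq by (metis parcs_parent_graph_iff)
      then have "f v = g v \<or> f (f v) = v"
        using step by (auto simp: parcs_parent_graph_iff)
      moreover have "f (f v) \<noteq> v"
        using parent_maps_periodic [OF f Suc.prems(2), of 2] False by (auto simp: numeral_2_eq_2)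
      ultimately show ?thesis by blast
    qed
  qed
  then show "f v = g v"
    using parent_mapsD(3,5) [OF f, of v] parent_mapsD(3) [OF g, of v] by (cases "v \<in> V") auto
qed

text \<open>Every path to the root contains all iterates of \<open>v\<close>, and some path contains
  nothing else.\<close>

lemma is_record_parent_graph_iff:
  assumes V: "finite V" and f: "f \<in> parent_maps V r" and v: "v \<in> V"
  shows "is_record (parent_graph V f) r v \<longleftrightarrow> (\<forall>i. (f ^^ i) v \<le> v)"
proof -
  interpret G: pair_graph "parent_graph V f"
    by (rule pair_graph_parent_graph [OF V])
  show ?thesis
  proof
    assume "is_record (parent_graph V f) r v"
    then obtain p where p: "G.apath v p r" and max: "v = Max (set (pawalk_verts v p))"
      by (auto simp: is_record_def)
    show "\<forall>i. (f ^^ i) v \<le> v"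
    proof
      fix i
      have "(f ^^ i) v \<in> set (pawalk_verts v p)"
        using parent_graph_awalk_contains_iterates [OF V f] p by (simp add: G.apath_def)
      then show "(f ^^ i) v \<le> v"
        using Max_ge [of "set (pawalk_verts v p)" "(f ^^ i) v"] max by simp
    qed
  next
    assume le: "\<forall>i. (f ^^ i) v \<le> v"
    obtain p where p: "G.awalk v p r" and verts: "set (pawalk_verts v p) \<subseteq> range (\<lambda>i. (f ^^ i) v)"
      using parent_graph_awalk_to_root [OF V f v] by blast
    \<comment> \<open>The walk along the iterates is shortened to a path, which only removes arcs,
      so its vertices are still iterates of \<open>v\<close>.\<close>
    define q where "q = G.awalk_to_apath p"
    have q: "G.apath v q r"
      unfolding q_def by (rule G.apath_awalk_to_apath [OF p])
    have "set q \<subseteq> set p"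
      unfolding q_def by (rule G.awalk_to_apath_subset [OF p])
    then have "set (pawalk_verts v q) \<subseteq> set (pawalk_verts v p)"
      using G.set_awalk_verts [OF p] G.set_awalk_verts [OF G.awalkI_apath [OF q]] by auto
    then have "x \<le> v" if "x \<in> set (pawalk_verts v q)" for x
      using that verts le by blast
    then have "Max (set (pawalk_verts v q)) = v"
      using G.hd_in_awalk_verts(2) [OF q] by (intro Max_eqI) auto
    with q show "is_record (parent_graph V f) r v"
      by (auto simp: is_record_def)
  qed
qed

lemma records_parent_graph:
  assumes "finite V" "f \<in> parent_maps V r"
  shows "records (parent_graph V f) r = map_records V f"
  using is_record_parent_graph_iff [OF assms] by (auto simp: records_def map_records_def)

text \<open>Sending each vertex to a neighbour closer to \<open>r\<close> gives a parent map whose graph is contained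
  in \<open>T\<close>; an additional edge would close a cycle.\<close>

lemma ex_parent_graph:
  assumes T: "pair_graph T" and con: "Digraph_Component.connected (with_proj T)"
    and acyclic: "\<not> (\<exists>c. pre_digraph.cycle (with_proj T) c \<and> 3 \<le> length c)"
    and r: "r \<in> pverts T"
  shows "\<exists>f \<in> parent_maps (pverts T) r. T = parent_graph (pverts T) f"
proof -
  interpret T: pair_graph T by fact
  define V where "V = pverts T"
  \<comment> \<open>The distance to \<open>r\<close>; the second vertex of a shortest walk is
    strictly closer and can serve as the parent.\<close>
  define d where "d = (\<lambda>v. LEAST l. \<exists>p. T.awalk v p r \<and> length p = l)"
  have reach: "\<exists>p. T.awalk v p r" if "v \<in> V" for v
  proof -
    have "v \<rightarrow>\<^sup>*\<^bsub>T\<^esub> r"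
      using con that r T.reachable_mk_symmetric_eq [OF T.sym_arcs]
      by (auto simp: Digraph_Component.connected_def strongly_connected_def V_def)
    then show ?thesis by (simp add: T.reachable_awalk)
  qed
  have d_le: "d v \<le> length p" if "T.awalk v p r" for v p
    unfolding d_def by (rule Least_le) (use that in blast)
  have closer: "\<exists>w. (v, w) \<in> parcs T \<and> d w < d v" if v: "v \<in> V" "v \<noteq> r" for v
  proof -
    have "\<exists>p. T.awalk v p r \<and> length p = d v"
      unfolding d_def by (rule LeastI_ex) (use reach [OF v(1)] in blast)
    then obtain p where p: "T.awalk v p r" "length p = d v" by blast
    then obtain e q where "p = e # q"
      using v(2) by (cases p) (auto simp: T.awalk_Nil_iff)
    with p have "e \<in> parcs T" "fst e = v" "T.awalk (snd e) q r" "length q < d v"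
      by (auto simp: T.awalk_Cons_iff)
    then show ?thesis
      using d_le [of "snd e" q] by (intro exI [of _ "snd e"]) auto
  qed
  define f where "f = (\<lambda>v. if v \<in> V \<and> v \<noteq> r then SOME w. (v, w) \<in> parcs T \<and> d w < d v else v)"
  have f_step: "(v, f v) \<in> parcs T" "d (f v) < d v" if "v \<in> V" "v \<noteq> r" for v
    using someI_ex [OF closer [OF that]] that by (simp_all add: f_def)
  have f_V: "f v \<in> V" if "v \<in> V" for v
    using f_step(1) [of v] that T.in_arcsD2 by (cases "v = r") (auto simp: V_def f_def)
  have f_reach: "\<exists>i. (f ^^ i) v = r" if "v \<in> V" for v
    using that
  proof (induction "d v" arbitrary: v rule: less_induct)
    case less
    show ?case
    proof (cases "v = r")
      case True
      then show ?thesis by (intro exI [of _ 0]) simp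
    next
      case False
      then obtain i where "(f ^^ i) (f v) = r"
        using less f_step(2) [of v] f_V by blast
      then have "(f ^^ Suc i) v = r" by (simp add: funpow_swap1)
      then show ?thesis by blast
    qed
  qed
  have "f v = v" if "v \<notin> V \<or> v = r" for v
    using that by (auto simp: f_def)
  then have f: "f \<in> parent_maps V r"
    using r f_V f_reach by (simp add: parent_maps_def V_def image_subset_iff)
  have fin: "finite V"
    unfolding V_def by (rule T.pair_finite_verts)
  interpret H: pair_graph "parent_graph V f"
    by (rule pair_graph_parent_graph [OF fin])
  have "(x, f x) \<in> parcs T" if "x \<in> V" "x \<noteq> f x" for x
    using f_step(1) [of x] that by (cases "x = r") (auto simp: f_def)
  then have sub: "parcs (parent_graph V f) \<subseteq> parcs T"
    using T.arcs_symmetric by (auto simp: parent_graph_def)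
  have "(u, w) \<in> parcs (parent_graph V f)" if uw: "(u, w) \<in> parcs T" for u w
  proof (rule ccontr)
    assume new: "(u, w) \<notin> parcs (parent_graph V f)"
    have "u \<in> V" "w \<in> V" "u \<noteq> w"
      using uw T.in_arcsD1 T.in_arcsD2 T.no_loops' by (auto simp: V_def)
    then have "w \<rightarrow>\<^sup>*\<^bsub>parent_graph V f\<^esub> u"
      using parent_graph_connected [OF fin f] H.reachable_mk_symmetric_eq [OF H.sym_arcs]
      by (auto simp: Digraph_Component.connected_def strongly_connected_def)
    then obtain p where p: "H.apath w p u"
      by (auto simp: H.reachable_apath)
    then have "w \<in> V" "set p \<subseteq> parcs (parent_graph V f)" "pcas w p u"
      by (simp_all add: H.apath_def H.awalk_def)
    then have walk: "T.awalk w p u"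
      using sub by (auto simp: T.awalk_def V_def)
    \<comment> \<open>The extra arc closes the path from \<open>w\<close> back to \<open>u\<close>
      that already exists in the parent graph.\<close>
    have "T.cycle ((u, w) # p)"
      unfolding T.cycle_def using p walk uw
      by (intro exI [of _ u]) (auto simp: T.awalk_Cons_iff H.apath_def)
    \<comment> \<open>Needed for a cycle of length 3: an empty \<open>p\<close> would make
      \<open>(u, w)\<close> a loop, and a single arc would be \<open>(w, u)\<close>, whose reverse
      would then be in the parent graph.\<close>
    moreover have "2 \<le> length p"
    proof (rule ccontr)
      assume "\<not> 2 \<le> length p"
      then consider "p = []" | e where "p = [e]"
        by (cases p; cases "tl p") auto
      then show False
      proof cases
        case 1
        then show False using p \<open>u \<noteq> w\<close> by (simp add: H.apath_Nil_iff)
      next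
        case 2
        then have "(w, u) \<in> parcs (parent_graph V f)"
          using p by (cases e) (auto simp: H.apath_Cons_iff H.apath_Nil_iff)
        then show False using new H.arcs_symmetric by blast
      qed
    qed
    ultimately show False using acyclic by force
  qed
  with sub have "parcs (parent_graph V f) = parcs T" by auto
  then have "T = parent_graph V f"
    by (intro pair_pre_digraph.equality) (simp_all add: V_def)
  with f show ?thesis unfolding V_def by blast
qed

section \<open>From parent maps back to rooted trees, and the count\<close>

lemma R_bullet_eq_card_record_trees: "R_bullet n k = card (record_trees {1..n} k)"
proof -
  have tree: "is_labelled_tree n (parent_graph {1..n} f)" if "f \<in> parent_maps {1..n} r" for f r
    using pair_graph_parent_graph [of "{1..n}" f] parent_graph_connected [OF _ that]
      parent_graph_no_cycle [OF _ that]
    by (auto simp: is_labelled_tree_def)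
  have "bij_betw (\<lambda>(r, f). (parent_graph {1..n} f, r)) (record_trees {1..n} k)
      {(T, r) \<in> rooted_trees n. card (records T r) = k}"
    (is "bij_betw ?G ?S ?T")
  proof (rule bij_betw_imageI)
    show "inj_on ?G ?S"
      by (rule inj_onI) (auto simp: record_trees_def dest: parent_graph_inject)
    show "?G ` ?S = ?T"
    proof (intro equalityI subsetI)
      fix t assume "t \<in> ?G ` ?S"
      then obtain r f where t: "t = (parent_graph {1..n} f, r)" and f: "f \<in> parent_maps {1..n} r"
        and k: "card (map_records {1..n} f) = k"
        by (auto simp: record_trees_def)
      show "t \<in> ?T"
        using tree [OF f] parent_mapsD(1) [OF f] k records_parent_graph [OF finite_atLeastAtMost f]
        by (simp add: t rooted_trees_def)
    next
      fix t assume "t \<in> ?T"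
      then obtain T r where t: "t = (T, r)" and T: "is_labelled_tree n T" and r: "r \<in> pverts T"
        and k: "card (records T r) = k"
        by (auto simp: rooted_trees_def)
      have V: "pverts T = {1..n}" using T by (simp add: is_labelled_tree_def)
      obtain f where f: "f \<in> parent_maps {1..n} r" and T_eq: "T = parent_graph {1..n} f"
        using ex_parent_graph [of T r] T r unfolding is_labelled_tree_def V by blast
      have "(r, f) \<in> ?S"
        using f k by (simp add: record_trees_def T_eq records_parent_graph)
      then show "t \<in> ?G ` ?S"
        by (rule rev_image_eqI) (simp add: t T_eq)
    qed
  qed
  then show ?thesis
    unfolding R_bullet_def by (rule bij_betw_same_card [symmetric])
qed

theorem mainTheorem1:
  fixes n k :: nat
  assumes "n \<ge> 1" and "1 \<le> k" and "k \<le> n"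
  shows "real (R_bullet n k) =
           real k * (\<Prod>i = 1..k - 1. real n - real i) * real n powi (int n - int k - 1)"
proof -
  have "real (R_bullet n k) = record_count n k"
    using card_parent_maps_record_trees(2) [of "{1..n}" k] assms
    by (simp add: R_bullet_eq_card_record_trees)
  also have "\<dots> = real k * (\<Prod>i = 1..k - 1. real n - real i) * real n powi (int n - int k - 1)"
    by (rule record_count_closed_form) (use assms in auto)
  finally show ?thesis .
qed

end
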